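(* Let $d\geq 3$ and $n \ge 2$ be natural numbers. Then there exist a polynomial $p$ of degree $d$ and a set $\Omega= \{z_1, z_2, \dots , z_n\}$ of $n$ distinct points in the complex plane such that $\Omega$ is a super-attracting cycle for the Newton map $N_p$. In fact the polynomial $p$ may be chosen to have real coefficients, and a cycle $\Omega$ may be found which consists entirely of real numbers.
   Context: For a complex polynomial $p$, the Newton map is the rational map $N_p:\widehat{\mathbb{C}}\to\widehat{\mathbb{C}}$, $N_p(z)=z-\frac{p(z)}{p'(z)}$, where $\widehat{\mathbb{C}}$ is the Riemann sphere. For a rational map $N$ and distinct points $z_1,\dots,z_n$, the set $\Omega=\{z_1,\dots,z_n\}$ is a cycle for $N$ if $N(z_i)=z_{i+1}$ for $1\le i\le n$, where $z_{n+1}:=z_1$. The cycle is super-attracting if its multiplier $\lambda=\prod_{i=1}^n N'(z_i)$ equals $0$. *)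

theory Defs
  imports "HOL-Analysis.Analysis" "HOL-Computational_Algebra.Computational_Algebra"
    "HOL-Computational_Algebra.Field_as_Ring"
begin

type_synonym sphere = "complex option"  \<comment> \<open>\<^term>\<open>None\<close> is the point at infinity\<close>

definition rat_num :: "complex poly fract \<Rightarrow> complex poly" where
  "rat_num R = fst (quot_of_fract R)"

definition rat_denom :: "complex poly fract \<Rightarrow> complex poly" where
  "rat_denom R = snd (quot_of_fract R)"

text \<open>Numerator and denominator are coprime, so a zero of the denominator is a pole.
  The value at infinity is the limit of the quotient, read off from the degrees.\<close>

fun rat_map :: "complex poly fract \<Rightarrow> sphere \<Rightarrow> sphere" where
  "rat_map R (Some z) =
     (if poly (rat_denom R) z = 0 then None
      else Some (poly (rat_num R) z / poly (rat_denom R) z))"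
| "rat_map R None =
     (if degree (rat_num R) > degree (rat_denom R) then None
      else Some (coeff (rat_num R) (degree (rat_denom R)) / lead_coeff (rat_denom R)))"

text \<open>Only meaningful at points that are not poles.\<close>

definition rat_deriv :: "complex poly fract \<Rightarrow> complex \<Rightarrow> complex" where
  "rat_deriv R z = deriv (\<lambda>w. poly (rat_num R) w / poly (rat_denom R) w) z"

definition newton_map :: "complex poly \<Rightarrow> complex poly fract" where
  "newton_map p = Fract [:0, 1:] 1 - Fract p 1 / Fract (pderiv p) 1"

text \<open>The cycle is the set of the points \<open>z 1, \<dots>, z n\<close>.\<close>

definition is_cycle :: "('a \<Rightarrow> 'a) \<Rightarrow> nat \<Rightarrow> (nat \<Rightarrow> 'a) \<Rightarrow> bool" where
  "is_cycle f n z \<longleftrightarrow> inj_on z {1..n} \<and>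
     (\<forall>i\<in>{1..n}. f (z i) = z (if i = n then 1 else i + 1))"

definition multiplier :: "complex poly fract \<Rightarrow> nat \<Rightarrow> (nat \<Rightarrow> complex) \<Rightarrow> complex" where
  "multiplier R n z = (\<Prod>i=1..n. rat_deriv R (z i))"

definition super_attracting_cycle ::
    "complex poly fract \<Rightarrow> nat \<Rightarrow> (nat \<Rightarrow> complex) \<Rightarrow> bool" where
  "super_attracting_cycle R n z \<longleftrightarrow>
     is_cycle (rat_map R) n (\<lambda>i. Some (z i)) \<and> multiplier R n z = 0"

end

theory Submission
  imports Defs
begin

text \<open>
  Newton's map of \<open>p = z^d - s z + s\<close> is
  \<open>N\<^sub>s(z) = ((d-1) z^d - s) / (d z^(d-1) - s)\<close>. For \<open>d \<ge> 3\<close> the origin is an inflection point of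
  \<open>p\<close>, so \<open>N\<^sub>s' = p p'' / p'\<^sup>2\<close> vanishes there, and a cycle through \<open>0\<close> is super-attracting. Since
  \<open>N\<^sub>s(0) = 1\<close> for every \<open>s > 0\<close>, it remains to choose a real \<open>s > 0\<close> for which the orbit of \<open>1\<close>
  first reaches \<open>0\<close> after exactly \<open>n - 1\<close> steps.

  The parameter is found by the intermediate value theorem. For \<open>s = 0\<close> the map is
  \<open>x \<mapsto> (d-1)/d x\<close>, and the orbit of \<open>1\<close> stays positive for ever. Increasing \<open>s\<close> up to the first
  value \<open>S\<^sub>k\<close> at which the \<open>k\<close>-th iterate \<open>y\<^sub>k\<close> vanishes (for \<open>k = 0\<close>, up to \<open>S\<^sub>0 = d\<close>), the numerator
  \<open>(d-1) y\<^sub>k^d - s\<close> of the next iterate goes from positive to negative, so it has a first zero \<open>S\<^sub>k\<^sub>+\<^sub>1 < S\<^sub>k\<close>. As the iterates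
  involved lie in \<open>(0,1]\<close>, the denominator is positive as long as the numerator is nonnegative
  (\<open>newton_denominator_pos\<close>): no pole is met, and \<open>y\<^sub>k\<^sub>+\<^sub>1\<close> is continuous up to \<open>S\<^sub>k\<^sub>+\<^sub>1\<close>. This is
  the induction of \<open>first_vanishing_parameter_step\<close>.

  On \<open>(0,1]\<close> the polynomial \<open>x^d + s (1 - x)\<close> is positive, so a Newton step with positive
  denominator strictly decreases the iterate; hence the points of the cycle are distinct.
\<close>

section \<open>Newton maps away from the critical points of the polynomial\<close>

text \<open>The reduced denominator divides any other denominator, so values of \<open>Fract a b\<close> off the
  zeros of \<open>b\<close> can be computed without reducing the fraction.\<close>

lemma poly_quot_of_Fract:
  fixes a b :: "complex poly"
  assumes "poly b z \<noteq> 0"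
  shows "poly (rat_denom (Fract a b)) z \<noteq> 0"
    and "poly (rat_num (Fract a b)) z / poly (rat_denom (Fract a b)) z = poly a z / poly b z"
proof -
  define u v where "u = rat_num (Fract a b)" and "v = rat_denom (Fract a b)"
  have b: "b \<noteq> 0" using assms by auto
  have v: "v \<noteq> 0" by (simp add: v_def rat_denom_def)
  have cop: "coprime u v"
    unfolding u_def v_def rat_num_def rat_denom_def by (rule coprime_quot_of_fract)
  have "Fract u v = Fract a b"
    by (simp add: u_def v_def rat_num_def rat_denom_def)
  then have eq: "u * b = a * v"
    using b v by (simp add: eq_fract)
  have "v dvd u * b" by (simp add: eq)
  then have "v dvd b"
    using cop by (simp add: coprime_dvd_mult_right_iff coprime_commute)
  then show vz: "poly (rat_denom (Fract a b)) z \<noteq> 0"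
    using assms unfolding v_def[symmetric] by (auto elim: dvdE)
  have "poly u z * poly b z = poly a z * poly v z"
    by (metis eq poly_mult)
  then show "poly (rat_num (Fract a b)) z / poly (rat_denom (Fract a b)) z
      = poly a z / poly b z"
    using assms vz unfolding u_def[symmetric] v_def[symmetric] by (simp add: field_simps)
qed

lemma newton_map_eq_Fract:
  assumes "pderiv p \<noteq> 0"
  shows "newton_map p = Fract ([:0, 1:] * pderiv p - p) (pderiv p)"
  using assms by (simp add: newton_map_def)

lemma rat_map_newton_map:
  assumes "poly (pderiv p) z \<noteq> 0"
  shows "rat_map (newton_map p) (Some z) = Some (z - poly p z / poly (pderiv p) z)"
proof -
  have "pderiv p \<noteq> 0" using assms by auto
  then show ?thesis
    using assms by (simp add: newton_map_eq_Fract poly_quot_of_Fract diff_divide_distrib)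
qed

text \<open>This is where super-attraction comes from: an inflection point of \<open>p\<close> with \<open>p' \<noteq> 0\<close> is a critical
  point of the Newton map, and it need not be a root of \<open>p\<close>.\<close>

lemma rat_deriv_newton_map:
  assumes "poly (pderiv p) z \<noteq> 0"
  shows "rat_deriv (newton_map p) z
    = poly p z * poly (pderiv (pderiv p)) z / (poly (pderiv p) z)\<^sup>2"
proof -
  let ?N = "newton_map p" and ?a = "[:0, 1:] * pderiv p - p" and ?b = "pderiv p"
  have N: "?N = Fract ?a ?b"
    using assms by (intro newton_map_eq_Fract) auto
  have "open {w. poly ?b w \<noteq> 0}"
    by (intro open_Collect_neq continuous_intros)
  then have "\<forall>\<^sub>F w in nhds z. poly ?b w \<noteq> 0"
    using assms eventually_nhds by blast
  then have "\<forall>\<^sub>F w in nhds z. poly (rat_num ?N) w / poly (rat_denom ?N) w = poly ?a w / poly ?b w"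
    by eventually_elim (simp add: N poly_quot_of_Fract del: poly_diff poly_mult)
  then have "rat_deriv ?N z = deriv (\<lambda>w. poly ?a w / poly ?b w) z"
    unfolding rat_deriv_def by (intro deriv_cong_ev) auto
  also have "\<dots> = (poly (pderiv ?a) z * poly ?b z - poly ?a z * poly (pderiv ?b) z)
      / (poly ?b z * poly ?b z)"
    by (intro DERIV_imp_deriv DERIV_divide poly_DERIV assms)
  also have "\<dots> = poly p z * poly (pderiv ?b) z / (poly ?b z)\<^sup>2"
    by (simp add: pderiv_mult pderiv_diff pderiv_pCons power2_eq_square algebra_simps)
  finally show ?thesis .
qed

section \<open>The real Newton iteration\<close>

definition newton_step :: "nat \<Rightarrow> real \<Rightarrow> real \<Rightarrow> real" where
  "newton_step d s x = (real (d - 1) * x ^ d - s) / (real d * x ^ (d - 1) - s)"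

abbreviation newton_iterate :: "nat \<Rightarrow> nat \<Rightarrow> real \<Rightarrow> real" where
  "newton_iterate d k s \<equiv> (newton_step d s ^^ k) 1"

text \<open>The condition is on the numerator of the next iterate only, because that is what the choice of
  \<open>s\<close> controls; the sign of the denominator and the bounds on the next iterate follow from it.\<close>

definition regular_point :: "nat \<Rightarrow> real \<Rightarrow> real \<Rightarrow> bool" where
  "regular_point d s x \<longleftrightarrow> 0 < x \<and> x \<le> 1 \<and> s \<le> real (d - 1) * x ^ d"

text \<open>On \<open>(0,1]\<close> one has \<open>d x^(d-1) \<ge> d x^d > (d-1) x^d\<close>, so the numerator changes sign before the
  denominator does.\<close>

lemma newton_denominator_pos:
  assumes "d \<ge> 1" "regular_point d s x"
  shows "s < real d * x ^ (d - 1)"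
proof -
  have x: "0 < x" "x \<le> 1" and s: "s \<le> real (d - 1) * x ^ d"
    using assms(2) by (auto simp: regular_point_def)
  have "s < real d * x ^ d"
    using s x assms(1) by (intro le_less_trans[OF s] mult_strict_right_mono) auto
  also have "\<dots> \<le> real d * x ^ (d - 1)"
    using x by (intro mult_left_mono power_decreasing) auto
  finally show ?thesis .
qed

lemma newton_step_le_1:
  assumes "d \<ge> 1" "regular_point d s x"
  shows "newton_step d s x \<le> 1"
proof -
  have x: "0 < x" "x \<le> 1" using assms(2) by (auto simp: regular_point_def)
  have "real (d - 1) * x ^ d \<le> real d * x ^ (d - 1)"
    using x by (intro mult_mono power_decreasing) auto
  then show ?thesis
    using newton_denominator_pos[OF assms] by (simp add: newton_step_def)
qed

text \<open>The identity \<open>x - p/p'\<close>, which serves both to compare with the Newton map of \<open>p\<close> and to see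
  that the step moves to the left.\<close>

lemma newton_step_eq:
  assumes "d \<ge> 1" "real d * x ^ (d - 1) \<noteq> s"
  shows "newton_step d s x = x - (x ^ d - s * x + s) / (real d * x ^ (d - 1) - s)"
proof -
  obtain e where "d = Suc e" using assms(1) by (cases d) auto
  then show ?thesis
    using assms(2) by (simp add: newton_step_def field_simps)
qed

lemma newton_step_less:
  assumes "d \<ge> 1" "regular_point d s x" "s \<ge> 0"
  shows "newton_step d s x < x"
proof -
  have x: "0 < x" "x \<le> 1" using assms(2) by (auto simp: regular_point_def)
  have "0 < x ^ d + s * (1 - x)"
    using x assms(3) by (intro add_pos_nonneg) auto
  then have "0 < (x ^ d - s * x + s) / (real d * x ^ (d - 1) - s)"
    using newton_denominator_pos[OF assms(1,2)] by (simp add: algebra_simps)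
  then show ?thesis
    using newton_denominator_pos[OF assms(1,2)] by (simp add: newton_step_eq[OF assms(1)])
qed

section \<open>The parameter at which an iterate first vanishes\<close>

lemma first_zero:
  fixes u :: "real \<Rightarrow> real"
  assumes "continuous_on {0..S} u" "u 0 > 0" "u S < 0" "S > 0"
  obtains m where "0 < m" "m < S" "u m = 0" "\<And>s. \<lbrakk>0 \<le> s; s < m\<rbrakk> \<Longrightarrow> u s > 0"
proof -
  define K where "K = {0..S} \<inter> u -` {..0}"
  have "compact K" unfolding K_def
    using continuous_closed_preimage[OF assms(1) closed_atLeastAtMost closed_atMost]
    by (metis Int_assoc Int_absorb compact_Icc compact_Int_closed)
  have "S \<in> K" using assms by (auto simp: K_def)
  then obtain m where m: "m \<in> K" "\<And>s. s \<in> K \<Longrightarrow> m \<le> s"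
    using compact_attains_inf[OF \<open>compact K\<close>] by blast
  have mS: "0 \<le> m" "m \<le> S" "u m \<le> 0" using m(1) by (auto simp: K_def)
  have pos: "u s > 0" if "0 \<le> s" "s < m" for s
    using m(2)[of s] that mS by (force simp: K_def)
  have "continuous_on {0..m} u"
    using assms(1) mS by (auto intro: continuous_on_subset)
  then obtain x where x: "0 \<le> x" "x \<le> m" "u x = 0"
    using IVT2'[of u m 0 0] mS assms(2) by auto
  then have "x = m" using pos[of x] by force
  then have "u m = 0" using x by simp
  then show thesis
    using that[of m] pos mS assms by (metis less_eq_real_def less_irrefl)
qed

text \<open>The induction hypothesis for the first \<open>k\<close> steps. The last conjunct asks only that the next
  numerator be negative at \<open>S\<close>; it holds when the \<open>k\<close>-th iterate vanishes there, and also for \<open>k = 0\<close>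
  and \<open>S = d\<close>, where the induction starts.\<close>

definition regular_parameters :: "nat \<Rightarrow> nat \<Rightarrow> real \<Rightarrow> bool" where
  "regular_parameters d k S \<longleftrightarrow> S > 0 \<and> continuous_on {0..S} (newton_iterate d k) \<and>
     (\<forall>s. 0 \<le> s \<and> s < S \<longrightarrow>
        (\<forall>j<k. regular_point d s (newton_iterate d j s)) \<and>
        0 < newton_iterate d k s \<and> newton_iterate d k s \<le> 1) \<and>
     real (d - 1) * newton_iterate d k S ^ d < S"

lemma first_vanishing_parameter_step:
  assumes d: "d \<ge> 2" and reg: "regular_parameters d k S"
  obtains m where "regular_parameters d (Suc k) m" "newton_iterate d (Suc k) m = 0"
    "\<And>j. j \<le> k \<Longrightarrow> regular_point d m (newton_iterate d j m)"
proof -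
  let ?y = "newton_iterate d k"
  define u where "u s = real (d - 1) * ?y s ^ d - s" for s
  have S: "S > 0" and cont: "continuous_on {0..S} ?y"
    and regj: "\<And>s j. \<lbrakk>0 \<le> s; s < S; j < k\<rbrakk> \<Longrightarrow> regular_point d s (newton_iterate d j s)"
    and y: "\<And>s. \<lbrakk>0 \<le> s; s < S\<rbrakk> \<Longrightarrow> 0 < ?y s \<and> ?y s \<le> 1"
    and uS: "u S < 0"
    using reg by (auto simp: regular_parameters_def u_def)
  have "continuous_on {0..S} u"
    unfolding u_def by (intro continuous_intros cont)
  moreover have "u 0 > 0"
    using y[of 0] S d by (simp add: u_def)
  ultimately obtain m where m: "0 < m" "m < S" "u m = 0" "\<And>s. \<lbrakk>0 \<le> s; s < m\<rbrakk> \<Longrightarrow> u s > 0"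
    using first_zero uS S by blast
  have um: "u s \<ge> 0" if "0 \<le> s" "s \<le> m" for s
    using m that by (cases "s = m") (auto intro: less_imp_le)
  have regle: "regular_point d s (newton_iterate d j s)" if "0 \<le> s" "s \<le> m" "j \<le> k" for s j
  proof (cases "j = k")
    case True
    then show ?thesis
      using um[of s] y[of s] that m by (simp add: regular_point_def u_def)
  next
    case False
    then show ?thesis using regj that m by simp
  qed
  have den: "real d * ?y s ^ (d - 1) - s > 0" if "0 \<le> s" "s \<le> m" for s
    using newton_denominator_pos[OF _ regle[OF that order_refl]] d by simp
  have den_nonzero: "\<forall>s\<in>{0..m}. real d * ?y s ^ (d - 1) - s \<noteq> 0"
    using den by (metis atLeastAtMost_iff less_irrefl)
  have eq: "newton_iterate d (Suc k) s = u s / (real d * ?y s ^ (d - 1) - s)" for s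
    by (simp add: newton_step_def u_def)
  have "continuous_on {0..m} ?y"
    using cont m by (auto intro: continuous_on_subset)
  then have "continuous_on {0..m} (newton_iterate d (Suc k))"
    unfolding eq u_def using den_nonzero by (intro continuous_intros)
  moreover have zero: "newton_iterate d (Suc k) m = 0"
    by (simp only: eq m(3) div_0)
  moreover have "0 < newton_iterate d (Suc k) s \<and> newton_iterate d (Suc k) s \<le> 1"
    if "0 \<le> s" "s < m" for s
  proof
    show "0 < newton_iterate d (Suc k) s"
      unfolding eq using m(4) den that by (intro divide_pos_pos) auto
    show "newton_iterate d (Suc k) s \<le> 1"
      using newton_step_le_1[OF _ regle[of s k]] that d by simp
  qed
  ultimately have "regular_parameters d (Suc k) m"
    unfolding regular_parameters_def using regle m(1) d
    by (auto simp: less_Suc_eq_le power_0_left simp del: funpow.simps)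
  then show thesis
    using that zero regle m(1) by (simp del: funpow.simps)
qed

lemma regular_parameters_exist:
  assumes "d \<ge> 2"
  shows "\<exists>S. regular_parameters d k S"
proof (induction k)
  case 0
  have "regular_parameters d 0 (real d)"
    using assms by (simp add: regular_parameters_def)
  then show ?case ..
next
  case (Suc k)
  then show ?case using first_vanishing_parameter_step[OF assms] by blast
qed

lemma vanishing_iterate_exists:
  assumes "d \<ge> 2"
  obtains s where "s > 0" "newton_iterate d (Suc k) s = 0"
    "\<And>j. j \<le> k \<Longrightarrow> regular_point d s (newton_iterate d j s)"
proof -
  obtain S where "regular_parameters d k S"
    using regular_parameters_exist[OF assms] by blast
  then show thesis
    using first_vanishing_parameter_step[OF assms] that
    by (metis regular_parameters_def)
qed

section \<open>The super-attracting cycle\<close>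

definition newton_trinomial :: "nat \<Rightarrow> real \<Rightarrow> complex poly" where
  "newton_trinomial d s = monom 1 d + [:of_real s, - of_real s:]"

lemma poly_newton_trinomial:
  "poly (newton_trinomial d s) (of_real x) = of_real (x ^ d - s * x + s)"
  by (simp add: newton_trinomial_def poly_monom)

lemma poly_pderiv_newton_trinomial:
  "poly (pderiv (newton_trinomial d s)) (of_real x) = of_real (real d * x ^ (d - 1) - s)"
  by (simp add: newton_trinomial_def pderiv_add pderiv_monom pderiv_pCons poly_monom)

lemma poly_pderiv2_newton_trinomial_0:
  assumes "d \<ge> 3"
  shows "poly (pderiv (pderiv (newton_trinomial d s))) 0 = 0"
  using assms by (simp add: newton_trinomial_def pderiv_add pderiv_monom pderiv_pCons poly_monom)

lemma degree_newton_trinomial: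
  assumes "d \<ge> 2"
  shows "degree (newton_trinomial d s) = d"
proof -
  have "degree [:of_real s, - of_real s :: complex:] < degree (monom (1::complex) d)"
    using assms by (simp add: degree_monom_eq)
  then show ?thesis
    unfolding newton_trinomial_def by (subst degree_add_eq_left) (auto simp: degree_monom_eq)
qed

lemma coeff_newton_trinomial_real: "coeff (newton_trinomial d s) k \<in> \<real>"
  by (auto simp: newton_trinomial_def coeff_pCons split: nat.split)

lemma rat_map_newton_trinomial:
  assumes "d \<ge> 1" "real d * x ^ (d - 1) \<noteq> s"
  shows "rat_map (newton_map (newton_trinomial d s)) (Some (of_real x))
    = Some (of_real (newton_step d s x))"
proof -
  have "poly (pderiv (newton_trinomial d s)) (of_real x) \<noteq> 0"
    unfolding poly_pderiv_newton_trinomial of_real_eq_0_iff using assms by simp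
  from rat_map_newton_map[OF this] show ?thesis
    unfolding poly_newton_trinomial poly_pderiv_newton_trinomial newton_step_eq[OF assms]
    by simp
qed

lemma real_super_attracting_cycle_exists:
  assumes d: "d \<ge> 3" and n: "n \<ge> 2"
  obtains s :: real and x :: "nat \<Rightarrow> real"
  where "super_attracting_cycle (newton_map (newton_trinomial d s)) n (\<lambda>i. of_real (x i))"
proof -
  \<comment> \<open>The cycle is \<open>0, y\<^sub>0 = 1, y\<^sub>1, \<dots>, y\<^bsub>n-2\<^esub>\<close>, and it closes up because \<open>y\<^bsub>n-1\<^esub> = 0\<close>.\<close>
  obtain s where s: "s > 0" and zero: "newton_iterate d (Suc (n - 2)) s = 0"
    and reg: "\<And>j. j \<le> n - 2 \<Longrightarrow> regular_point d s (newton_iterate d j s)"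
    using vanishing_iterate_exists[of d "n - 2"] d by auto
  define p where "p = newton_trinomial d s"
  define x where "x i = (newton_step d s ^^ (i - 1)) 0" for i
  have x1: "x 1 = 0" by (simp add: x_def)
  have step0: "newton_step d s 0 = 1"
    using s d by (simp add: newton_step_def power_0_left)
  have x_iter: "x (j + 2) = newton_iterate d j s" for j
    by (simp add: x_def funpow_swap1 step0)
  have x_Suc: "newton_step d s (x i) = x (i + 1)" if "i \<ge> 1" for i
    using that by (cases i) (auto simp: x_def)
  have x_reg: "regular_point d s (x i)" if "2 \<le> i" "i \<le> n" for i
  proof -
    obtain j where "i = j + 2"
      using \<open>2 \<le> i\<close> by (metis le_add_diff_inverse2)
    then show ?thesis
      using reg[of j] that(2) x_iter[of j] by simp
  qed
  have x_wrap: "x (n + 1) = 0"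
    using zero x_iter[of "Suc (n - 2)"] n by (simp add: numeral_2_eq_2 Suc_diff_Suc)
  have den: "real d * x i ^ (d - 1) \<noteq> s" if "i \<in> {1..n}" for i
  proof (cases "i = 1")
    case True
    then show ?thesis using s d x1 by (simp add: power_0_left)
  next
    case False
    then show ?thesis
      using newton_denominator_pos[OF _ x_reg[of i]] that d by simp
  qed
  have less: "x j < x i" if "2 \<le> i" "i < j" "j \<le> n" for i j
    using that(2,3)
  proof (induction j rule: less_induct)
    case (less j)
    have "x j < x (j - 1)"
      using newton_step_less[of d s "x (j - 1)"] x_reg[of "j - 1"] x_Suc[of "j - 1"]
        less.prems that(1) s d by simp
    moreover have "i = j - 1 \<or> i < j - 1" "j - 1 < j" "j - 1 \<le> n"
      using less.prems by linarith+
    ultimately show ?case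
      using less.IH[of "j - 1"] by fastforce
  qed
  have pos: "x i > 0" if "2 \<le> i" "i \<le> n" for i
    using x_reg[OF that] by (simp add: regular_point_def)
  have "x i \<noteq> x j" if "i \<in> {1..n}" "j \<in> {1..n}" "i < j" for i j
    using that less[of i j] pos[of j] x1 by (cases "i = 1") auto
  then have inj: "inj_on x {1..n}"
    by (intro linorder_inj_onI') auto
  have "is_cycle (rat_map (newton_map p)) n (\<lambda>i. Some (of_real (x i)))"
    unfolding is_cycle_def
  proof (intro conjI ballI)
    show "inj_on (\<lambda>i. Some (complex_of_real (x i))) {1..n}"
    proof (rule inj_onI)
      fix i j assume "i \<in> {1..n}" "j \<in> {1..n}"
        and "Some (complex_of_real (x i)) = Some (complex_of_real (x j))"
      then show "i = j" using inj_onD[OF inj, of i j] by simp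
    qed
  next
    fix i assume i: "i \<in> {1..n}"
    have "rat_map (newton_map p) (Some (of_real (x i))) = Some (of_real (newton_step d s (x i)))"
      unfolding p_def using d by (intro rat_map_newton_trinomial den[OF i]) simp
    also have "newton_step d s (x i) = x (i + 1)"
      using x_Suc i by simp
    also have "\<dots> = x (if i = n then 1 else i + 1)"
      using x_wrap x1 by simp
    finally show "rat_map (newton_map p) (Some (of_real (x i)))
        = Some (of_real (x (if i = n then 1 else i + 1)))" .
  qed
  moreover have "multiplier (newton_map p) n (\<lambda>i. of_real (x i)) = 0"
  proof -
    have "poly (pderiv p) 0 \<noteq> 0"
      using poly_pderiv_newton_trinomial[of d s 0] s d by (simp add: p_def power_0_left)
    then have "rat_deriv (newton_map p) 0 = 0"
      using poly_pderiv2_newton_trinomial_0[OF d] by (simp add: rat_deriv_newton_map p_def)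
    then have "rat_deriv (newton_map p) (of_real (x 1)) = 0"
      by (simp only: x1 of_real_0)
    moreover have "1 \<in> {1..n}" using n by simp
    ultimately show ?thesis
      unfolding multiplier_def by (intro prod_zero bexI[of _ 1]) simp_all
  qed
  ultimately show thesis
    using that[of s x] unfolding super_attracting_cycle_def p_def by blast
qed

theorem theorem3:
  fixes d n :: nat
  assumes "d \<ge> 3" and "n \<ge> 2"
  shows "(\<exists>(p :: complex poly) (z :: nat \<Rightarrow> complex).
            degree p = d \<and> super_attracting_cycle (newton_map p) n z) \<and>
         (\<exists>(p :: complex poly) (z :: nat \<Rightarrow> complex).
            degree p = d \<and> (\<forall>k. coeff p k \<in> \<real>) \<and>
            super_attracting_cycle (newton_map p) n z \<and> (\<forall>i\<in>{1..n}. z i \<in> \<real>))"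
proof -
  obtain s :: real and x :: "nat \<Rightarrow> real"
    where "super_attracting_cycle (newton_map (newton_trinomial d s)) n (\<lambda>i. of_real (x i))"
    using real_super_attracting_cycle_exists[OF assms] .
  moreover have "degree (newton_trinomial d s) = d"
    using degree_newton_trinomial assms(1) by simp
  ultimately show ?thesis
    using coeff_newton_trinomial_real Reals_of_real by blast
qed

end
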